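(* Let $n,m$ be positive integers. Write $n=am+b$ with integers $a\ge 0$ and $0\le b<m$, and set $k=\lfloor n/(a+b)\rfloor$. Then $\nu_0(\mathrm{Shift}(n,m))\ge k$.
   Context: $\mathrm{Shift}(n,m)$ is the directed Cayley graph of $\mathbb{Z}_n$ with generators $\{1,m\}$. Its vertex set is $\{0,1,\dots,n-1\}$, and it has arcs $i\to i+1 \pmod n$ and $i\to i+m \pmod n$ for every vertex $i$. Cycles are directed. For a directed graph $G$, the cycle packing number $\nu_0(G)$ is the maximum number of pairwise vertex-disjoint directed cycles in $G$. *)

theory Defs
  imports "Graph_Theory.Graph_Theory" Complex_Main
begin

text \<open>
  For \<open>m mod n = 1 mod n\<close> the two generators give the same arc, stored once; this has no influence on
  vertex-disjoint cycles. Loops (\<open>n = 1\<close> or \<open>n dvd m\<close>) are kept.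
\<close>

definition Shift :: "nat \<Rightarrow> nat \<Rightarrow> nat pair_pre_digraph" where
  "Shift n m = \<lparr> pverts = {0..<n},
     parcs = {(i, (i + 1) mod n) | i. i < n} \<union> {(i, (i + m) mod n) | i. i < n} \<rparr>"

text \<open>
  The library's \<open>cycle\<close> is a nonempty closed directed walk, given as a list of arcs, without repeated
  vertices; loops and 2-cycles are cycles. The vertices of a cycle are the tails of its arcs. The
  arc lists of one cycle read from two different starting points share their vertices, so a
  packing contains at most one of them.
\<close>

definition cycle_packing :: "('a, 'b) pre_digraph \<Rightarrow> 'b list set \<Rightarrow> bool" where
  "cycle_packing G C \<longleftrightarrow>
     (\<forall>p\<in>C. pre_digraph.cycle G p) \<and>
     pairwise (\<lambda>p q. disjnt (tail G ` set p) (tail G ` set q)) C"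

definition cycle_packing_number :: "('a, 'b) pre_digraph \<Rightarrow> nat" (\<open>\<nu>\<^sub>0\<close>) where
  "\<nu>\<^sub>0 G = Max {card C | C. finite C \<and> cycle_packing G C}"

text \<open>The maximum is taken over a finite nonempty set if the graph is finite.\<close>

lemma card_cycle_packing_le:
  assumes "fin_digraph G" "cycle_packing G C"
  shows "finite C" "card C \<le> card (verts G)"
proof -
  interpret fin_digraph G by fact
  define f where "f p = tail G (hd p)" for p
  have ne: "p \<noteq> []" and sub: "set p \<subseteq> arcs G" if "p \<in> C" for p
    using assms(2) that unfolding cycle_packing_def cycle_def awalk_def by blast+
  have inj: "inj_on f C"
  proof (rule inj_onI, rule ccontr)
    fix p q assume pq: "p \<in> C" "q \<in> C" "f p = f q" "p \<noteq> q"
    then have "disjnt (tail G ` set p) (tail G ` set q)"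
      using assms(2) unfolding cycle_packing_def pairwise_def by blast
    moreover have "f p \<in> tail G ` set p" "f p \<in> tail G ` set q"
      using imageI[OF hd_in_set[OF ne[OF pq(1)]], of "tail G"]
        imageI[OF hd_in_set[OF ne[OF pq(2)]], of "tail G"] pq(3) by (simp_all add: f_def)
    ultimately show False by (auto simp: disjnt_def)
  qed
  have img: "f ` C \<subseteq> verts G"
  proof (rule image_subsetI)
    fix p assume "p \<in> C"
    then have "hd p \<in> arcs G" using ne sub hd_in_set by blast
    then show "f p \<in> verts G" by (simp add: f_def)
  qed
  show "finite C" by (rule finite_imageD[OF finite_subset[OF img finite_verts] inj])
  show "card C \<le> card (verts G)" using inj img finite_verts by (rule card_inj_on_le)
qed

lemma cycle_packing_cards:
  assumes "fin_digraph G"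
  shows "finite {card C | C. finite C \<and> cycle_packing G C}"
    and "{card C | C. finite C \<and> cycle_packing G C} \<noteq> {}"
proof -
  have "{card C | C. finite C \<and> cycle_packing G C} \<subseteq> {..card (verts G)}"
    using card_cycle_packing_le[OF assms] by auto
  then show "finite {card C | C. finite C \<and> cycle_packing G C}"
    by (rule finite_subset) simp
  have "cycle_packing G {}" by (simp add: cycle_packing_def)
  then show "{card C | C. finite C \<and> cycle_packing G C} \<noteq> {}" by blast
qed

lemma pair_fin_digraph_Shift: "pair_fin_digraph (Shift n m)"
  by unfold_locales (auto simp: Shift_def)

end

theory Submission
  imports Defs
begin

text \<open>
  Let \<open>a > 0\<close> and \<open>g s = \<lfloor>b s / a\<rfloor>\<close>, so that \<open>g (s + a) = g s + b\<close>. The \<open>j\<close>-th cycle, \<open>j < k\<close>, enters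
  row \<open>r\<close> of the vertex set (the \<open>r\<close>-th block of \<open>m\<close> vertices) at column \<open>j + g (j + r)\<close>, takes unit
  steps up to column \<open>j + g (j + r + 1)\<close>, and jumps by \<open>m\<close> into row \<open>r + 1\<close>. After \<open>a\<close> rows it has
  advanced by \<open>a m + b = n\<close> and closes up. Cycle \<open>j\<close> leaves row \<open>r\<close> just before the column
  \<open>j + 1 + g (j + 1 + r)\<close> at which cycle \<open>j + 1\<close> enters it, and the last cycle leaves row \<open>r\<close> before
  the first one enters row \<open>r + 1\<close> because \<open>b (k - 1) \<le> a (m - k)\<close>, which is
  \<open>k (a + b) \<le> n\<close> rearranged.
\<close>

text \<open>A walk of length \<open>card S\<close> that stays in \<open>S\<close> lists
  \<open>card S + 1\<close> vertices, so it repeats one, and the closed part between the repetitions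
  contains a cycle. Walking in the induced subgraph keeps that cycle inside
  \<open>S\<close>.\<close>

lemma (in wf_digraph) cycle_in_closed_set:
  assumes "finite S" "S \<noteq> {}" "S \<subseteq> verts G"
    and succ: "\<And>u. u \<in> S \<Longrightarrow> \<exists>e\<in>arcs G. tail G e = u \<and> head G e \<in> S"
  obtains p where "cycle p" "tail G ` set p \<subseteq> S"
proof -
  let ?H = "G \<restriction> S"
  have ind: "induced_subgraph ?H G" using assms(3) by (rule induced_induce)
  interpret H: wf_digraph ?H using ind by (rule wf_digraphI_induced)
  have walk: "\<exists>p v. H.awalk u p v \<and> length p = l" if "u \<in> S" for u l
    using that
  proof (induction l arbitrary: u)
    case 0
    then have "H.awalk u [] u" by (simp add: H.awalk_Nil_iff)
    then show ?case by auto
  next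
    case (Suc l)
    obtain e where e: "e \<in> arcs G" "tail G e = u" "head G e \<in> S"
      using succ Suc.prems by blast
    then obtain p v where "H.awalk (head G e) p v" "length p = l"
      using Suc.IH by blast
    then have "H.awalk u (e # p) v \<and> length (e # p) = Suc l"
      using e Suc.prems by (simp add: H.awalk_Cons_iff)
    then show ?case by blast
  qed
  obtain u where "u \<in> S" using assms(2) by blast
  then obtain p v where p: "H.awalk u p v" "length p = card S" using walk by blast
  have "set (H.awalk_verts u p) \<subseteq> S"
    using p(1) by (metis H.awalkE induce_subgraph_verts)
  then have "card (set (H.awalk_verts u p)) \<le> card S"
    using assms(1) by (rule card_mono[rotated])
  then have "\<not> distinct (H.awalk_verts u p)"
    using p(2) by (auto simp: H.length_awalk_verts dest: distinct_card)
  then obtain q where "H.closed_w q"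
    using H.awalk_not_distinct_decomp[OF p(1)] by (auto simp: H.closed_w_def)
  then obtain c where c: "H.cycle c" using H.closed_w_imp_cycle by blast
  have "cycle c" using induced_imp_subgraph[OF ind] c by (rule subgraph_cycle)
  moreover have "tail G ` set c \<subseteq> S"
    using c by (auto simp: H.cycle_def H.awalk_def)
  ultimately show thesis by (rule that)
qed

text \<open>Reduces a packing to disjoint vertex sets in which every vertex has a successor, so that
  no arc lists need to be written down. Different indices yield different cycles, since a shared one
  would have a tail set disjoint from itself.\<close>

lemma cycle_packing_number_ge:
  assumes "fin_digraph G" "finite I"
    and "\<And>i. i \<in> I \<Longrightarrow> S i \<noteq> {}" "\<And>i. i \<in> I \<Longrightarrow> S i \<subseteq> verts G"
    and "\<And>i u. i \<in> I \<Longrightarrow> u \<in> S i \<Longrightarrow> \<exists>e\<in>arcs G. tail G e = u \<and> head G e \<in> S i"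
    and disj: "\<And>i j. i \<in> I \<Longrightarrow> j \<in> I \<Longrightarrow> i \<noteq> j \<Longrightarrow> disjnt (S i) (S j)"
  shows "card I \<le> \<nu>\<^sub>0 G"
proof -
  interpret fin_digraph G by fact
  have "\<exists>p. cycle p \<and> tail G ` set p \<subseteq> S i" if "i \<in> I" for i
    using cycle_in_closed_set[of "S i"] assms(3-5) that finite_subset[OF _ finite_verts] by metis
  then obtain p where p: "\<And>i. i \<in> I \<Longrightarrow> cycle (p i)" "\<And>i. i \<in> I \<Longrightarrow> tail G ` set (p i) \<subseteq> S i"
    by metis
  have pdisj: "disjnt (tail G ` set (p i)) (tail G ` set (p j))" if "i \<in> I" "j \<in> I" "i \<noteq> j" for i j
    using p(2) disj that by (meson disjnt_subset1 disjnt_subset2)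
  have "inj_on p I"
  proof (rule inj_onI, rule ccontr)
    fix i j assume ij: "i \<in> I" "j \<in> I" "p i = p j" "i \<noteq> j"
    then have "p i = []" using pdisj[of i j] by (simp add: disjnt_def)
    then show False using p(1)[OF ij(1)] by (simp add: cycle_def)
  qed
  then have "card (p ` I) = card I" by (rule card_image)
  moreover have "cycle_packing G (p ` I)"
    using p(1) pdisj by (auto simp: cycle_packing_def pairwise_def)
  ultimately have "card I \<in> {card C | C. finite C \<and> cycle_packing G C}"
    using assms(2) by (metis (mono_tags, lifting) finite_imageI mem_Collect_eq)
  then show ?thesis
    unfolding cycle_packing_number_def
    using cycle_packing_cards(1)[OF assms(1)] by (rule Max_ge[rotated])
qed

lemma fin_digraph_Shift: "fin_digraph (with_proj (Shift n m))"
proof -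
  interpret pair_fin_digraph "Shift n m" by (rule pair_fin_digraph_Shift)
  show ?thesis by unfold_locales
qed

lemma Shift_arcI:
  assumes "u < n" "v = (u + 1) mod n \<or> v = (u + m) mod n"
  shows "(u, v) \<in> parcs (Shift n m)"
  using assms by (auto simp: Shift_def)

lemma cycle_packing_number_Shift_ge:
  fixes n m a b k :: nat
  assumes "a > 0" and n: "n = a * m + b" and k: "k * (a + b) \<le> n"
  shows "k \<le> \<nu>\<^sub>0 (with_proj (Shift n m))"
proof (cases "k = 0")
  case False
  define g where "g s = b * s div a" for s
  \<comment> \<open>The vertices of the \<open>j\<close>-th cycle; \<open>v\<close> is the column
    without the shift \<open>j\<close>. The upper end is included, being the vertex from which the
    cycle jumps.\<close>
  define S where "S j = {r * m + j + v | r v. r < a \<and> g (j + r) \<le> v \<and> v \<le> g (j + r + 1)}" for j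
  have g_mono: "g s \<le> g t" if "s \<le> t" for s t
    using that by (simp add: g_def div_le_mono)
  have g_period: "g (s + a) = g s + b" for s
    using \<open>a > 0\<close> by (simp add: g_def algebra_simps)
  \<comment> \<open>With \<open>s = r + 1\<close>, the left side is the column where cycle
    \<open>j\<close> leaves row \<open>r\<close>, the right side the one where cycle 0 enters row
    \<open>r + 1\<close>, counted from the start of row \<open>r\<close>. The worst case is
    \<open>j = k - 1\<close>.\<close>
  have gap: "j + g (j + s) < m + g s" if "j < k" for j s
  proof -
    have "k = Suc (k - 1)" using False by simp
    \<comment> \<open>One \<open>b\<close> cancels from \<open>k * (a + b) \<le> a * m + b\<close>.
      Keeping \<open>a * k\<close> rather than \<open>a * (k - 1)\<close> makes the final inequality
      strict.\<close>
    then have "b * (k - 1) + a * k \<le> a * m"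
      using k n by (metis (no_types, lifting) add.assoc add.commute add_le_cancel_left add_mult_distrib2 mult.commute mult_Suc)
    then have "b * (k - 1 + s) + a * k \<le> b * s + a * m"
      by (simp add: algebra_simps)
    then have "(b * (k - 1 + s) + a * k) div a \<le> (b * s + a * m) div a"
      by (rule div_le_mono)
    then have "g (k - 1 + s) + k \<le> g s + m"
      using \<open>a > 0\<close> by (simp add: g_def)
    moreover have "g (j + s) \<le> g (k - 1 + s)" using that by (intro g_mono) simp
    ultimately show ?thesis using that by linarith
  qed
  have row: "x < (r + 1) * m + g (r + 1)"
    if "x = r * m + j + v" "v \<le> g (j + r + 1)" "j < k" for x r j v
    using gap[OF that(3), of "r + 1"] that(1,2) by (simp add: algebra_simps)
  \<comment> \<open>Columns may reach \<open>m\<close>, so division by \<open>m\<close> does not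
    recover the row. Instead, the entry of cycle 0 into row \<open>r + 1\<close> separates row
    \<open>r\<close> of any cycle from all later rows.\<close>
  have rows: "r' \<le> r" if "r * m + j + v = r' * m + j' + v'" "v \<le> g (j + r + 1)" "j < k"
    "g (j' + r') \<le> v'" for r j v r' j' v'
  proof (rule ccontr)
    assume "\<not> r' \<le> r"
    then have "(r + 1) * m \<le> r' * m" "g (r + 1) \<le> g (j' + r')"
      by (intro mult_le_mono1 g_mono; simp)+
    then show False using row[OF refl that(2,3)] that(1,4) by linarith
  qed
  have S_bound: "x < n" if "x \<in> S j" "j < k" for x j
  proof -
    obtain r v where rv: "x = r * m + j + v" "r < a" "v \<le> g (j + r + 1)"
      using \<open>x \<in> S j\<close> by (auto simp: S_def)
    have "x < (r + 1) * m + g (r + 1)" using row rv \<open>j < k\<close> by blast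
    also have "\<dots> \<le> a * m + g (0 + a)"
      using rv(2) by (intro add_mono[OF mult_le_mono1 g_mono]) simp_all
    \<comment> \<open>Cycle 0 would enter row \<open>a\<close> exactly at \<open>n\<close>, as
      \<open>g 0 = 0\<close>.\<close>
    also have "\<dots> = n" unfolding g_period by (simp add: n g_def)
    finally show ?thesis .
  qed
  have S_disj: "disjnt (S i) (S j)" if "i < j" "j < k" for i j
  proof (rule ccontr)
    assume "\<not> disjnt (S i) (S j)"
    then obtain r v r' v' where x: "r * m + i + v = r' * m + j + v'"
      "g (i + r) \<le> v" "v \<le> g (i + r + 1)" "g (j + r') \<le> v'" "v' \<le> g (j + r' + 1)"
      by (auto simp: S_def disjnt_def)
    have "r = r'"
      using rows[OF x(1,3) _ x(4)] rows[OF x(1)[symmetric] x(5) _ x(2)] that by simp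
    \<comment> \<open>Hence \<open>v \<le> v'\<close>, and \<open>i < j\<close> makes the two
      vertices differ.\<close>
    moreover have "g (i + r + 1) \<le> g (j + r)" using that by (intro g_mono) simp
    ultimately show False using x that by simp
  qed
  have S_start: "j + g j \<in> S j" for j
  proof -
    have "j + g j = 0 * m + j + g j" "g (j + 0) \<le> g j" "g j \<le> g (j + 0 + 1)"
      by (simp_all add: g_mono)
    then show ?thesis using \<open>a > 0\<close> unfolding S_def by blast
  qed
  have S_succ: "\<exists>w\<in>S j. w = (u + 1) mod n \<or> w = (u + m) mod n" if "u \<in> S j" "j < k" for u j
  proof -
    obtain r v where rv: "u = r * m + j + v" "r < a" "g (j + r) \<le> v" "v \<le> g (j + r + 1)"
      using \<open>u \<in> S j\<close> by (auto simp: S_def)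
    consider "v < g (j + r + 1)" | "v = g (j + r + 1)" "r + 1 < a" | "v = g (j + r + 1)" "r + 1 = a"
      using rv by linarith
    then show ?thesis
    proof cases
      case 1
      then have "u + 1 = r * m + j + (v + 1)" "g (j + r) \<le> v + 1" "v + 1 \<le> g (j + r + 1)"
        using rv by simp_all
      then have "u + 1 \<in> S j" using rv(2) unfolding S_def by blast
      then show ?thesis using S_bound \<open>j < k\<close> by (metis mod_less)
    next
      case 2
      \<comment> \<open>The jump keeps the column, and the exit column of row \<open>r\<close> is
        the entry column of row \<open>r + 1\<close>.\<close>
      have "u + m = (r + 1) * m + j + v" "g (j + (r + 1)) \<le> v" "v \<le> g (j + (r + 1) + 1)"
        using rv 2 g_mono[of "j + r + 1" "j + (r + 1) + 1"] by (simp_all add: add.assoc)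
      then have "u + m \<in> S j" using 2(2) unfolding S_def by blast
      then show ?thesis using S_bound \<open>j < k\<close> by (metis mod_less)
    next
      case 3
      have "v = g j + b" using 3 g_period[of j] by (metis add.assoc)
      moreover have "r * m + m = a * m" using 3(2) by (metis add.commute mult_Suc Suc_eq_plus1)
      ultimately have "u + m = j + g j + n" using rv(1) n by simp
      then have "(u + m) mod n = j + g j" using S_bound[OF S_start \<open>j < k\<close>] by simp
      then show ?thesis using S_start by metis
    qed
  qed
  have "card {..<k} \<le> \<nu>\<^sub>0 (with_proj (Shift n m))"
  proof (rule cycle_packing_number_ge[where S = S])
    show "fin_digraph (with_proj (Shift n m))"
      by (rule fin_digraph_Shift)
    show "S j \<noteq> {}" for j using S_start by blast
    show "S j \<subseteq> verts (with_proj (Shift n m))" if "j \<in> {..<k}" for j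
      using S_bound that by (auto simp: Shift_def)
    show "\<exists>e\<in>arcs (with_proj (Shift n m)). tail (with_proj (Shift n m)) e = u \<and>
        head (with_proj (Shift n m)) e \<in> S j" if "j \<in> {..<k}" "u \<in> S j" for j u
    proof -
      obtain w where "w \<in> S j" "w = (u + 1) mod n \<or> w = (u + m) mod n"
        using S_succ \<open>j \<in> {..<k}\<close> \<open>u \<in> S j\<close> by blast
      then show ?thesis
        using Shift_arcI[of u n w m] S_bound that by (intro bexI[of _ "(u, w)"]) auto
    qed
    show "disjnt (S i) (S j)" if "i \<in> {..<k}" "j \<in> {..<k}" "i \<noteq> j" for i j
      using that S_disj[of i j] S_disj[of j i] by (auto simp: disjnt_sym neq_iff)
  qed simp
  then show ?thesis by simp
qed simp

text \<open>Serves the case \<open>a = 0\<close>, where \<open>g\<close> is of no use and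
  \<open>k = 1\<close>; the whole vertex set is the single closed set.\<close>

lemma cycle_packing_number_Shift_pos:
  assumes "n > 0"
  shows "1 \<le> \<nu>\<^sub>0 (with_proj (Shift n m))"
proof -
  have "card {()} \<le> \<nu>\<^sub>0 (with_proj (Shift n m))"
  proof (rule cycle_packing_number_ge[where S = "\<lambda>_. {0..<n}"])
    show "fin_digraph (with_proj (Shift n m))"
      by (rule fin_digraph_Shift)
    show "\<exists>e\<in>arcs (with_proj (Shift n m)). tail (with_proj (Shift n m)) e = u \<and>
        head (with_proj (Shift n m)) e \<in> {0..<n}" if "u \<in> {0..<n}" for u
      using Shift_arcI[of u n "(u + 1) mod n" m] that
      by (intro bexI[of _ "(u, (u + 1) mod n)"]) auto
  qed (use assms in \<open>auto simp: Shift_def\<close>)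
  then show ?thesis by simp
qed

theorem theorem6:
  fixes n m a b k :: nat
  assumes "n > 0" and "m > 0"
    and "n = a * m + b" and "b < m"
    and "k = nat \<lfloor>real n / real (a + b)\<rfloor>"
  shows "\<nu>\<^sub>0 (with_proj (Shift n m)) \<ge> k"
proof -
  have k: "k = n div (a + b)"
    unfolding assms(5) by (simp only: floor_divide_of_nat_eq nat_int)
  show ?thesis
  proof (cases "a = 0")
    case True
    then have "k = 1" using k assms(1,3) by simp
    then show ?thesis using cycle_packing_number_Shift_pos[OF assms(1)] by simp
  next
    case False
    have "k * (a + b) \<le> n" unfolding k by (rule div_times_less_eq_dividend)
    then show ?thesis using cycle_packing_number_Shift_ge[OF _ assms(3)] False by simp
  qed
qed

end
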